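(* Let $k\ge3$ be an integer, and let $\ell\ge2$ be a natural number such that either $\ell\in\{k-3,k-2,k-1\}$, or $k\in\{6,7,8,9\}$ and $\ell=k-4$. Let $X$ be a random variable with values in a measurable space $(S,\Sigma)$ and $Y$ a random variable with values in $[k]=\{1,\dots,k\}$, both on the same probability space, such that for each $x\in S$ the vector $(\rho_1(x),\dots,\rho_k(x))$ is a permutation of the vector $(a_1,\dots,a_k)$, where $$a_i=\frac1\ell\,\mathrm I\{1\le i\le\ell\}\qquad\text{for all } i=1,\dots,k.$$ Then $L(\Delta)>L_{\mathrm{FM}}(H)$.
   Context: Let $\mathsf P$ be the underlying probability measure. For $y\in[k]$, $\mu_y(B):=\mathsf P(Y=y,\,X\in B)$ for $B\in\Sigma$; $\mu:=\mu_1+\dots+\mu_k$ is the distribution of $X$; $\rho_y:=\frac{d\mu_y}{d\mu}$ is the density of $\mu_y$ with respect to $\mu$. $\mathrm I\{\cdot\}$ denotes the indicator. $\Delta:=\sum_{1\le y<z\le k}\|\mu_y-\mu_z\|=\sum_{1\le y<z\le k}\int_S|\rho_y-\rho_z|\,d\mu$, where $\|\cdot\|$ is the total variation norm (no factor $1/2$), and $L(\Delta):=1-\frac{1+\Delta}{k}$. $H:=H(Y|X):=-\int_S\mu(dx)\sum_{y=1}^k\rho_y(x)\ln\rho_y(x)$ is the conditional entropy (natural logarithms, $0\ln0:=0$); it takes values in $[0,\ln k]$. $L_{\mathrm{FM}}(H):=\Phi^{-1}(H)$, where $\Phi(p):=p\ln(k-1)+h_2(p)$, $h_2(p):=-p\ln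 p-(1-p)\ln(1-p)$ for $p\in(0,1)$, and $h_2(0):=h_2(1):=0$. The function $\Phi$ is continuous and strictly increasing from $0$ to $\ln k$ as $p$ increases from $0$ to $1-\frac1k$, and $\Phi^{-1}\colon[0,\ln k]\to[0,1-\frac1k]$ is the inverse of this restriction. *)

theory Defs
  imports "HOL-Probability.Probability" "HOL-Combinatorics.Permutations"
begin

definition tv_norm :: "'s measure \<Rightarrow> ('s set \<Rightarrow> real) \<Rightarrow> real" where
  "tv_norm S \<nu> =
     (SUP P \<in> {P. partition_on (space S) P \<and> finite P \<and> P \<subseteq> sets S}. \<Sum>A\<in>P. \<bar>\<nu> A\<bar>)"

definition class_distr ::
  "'w measure \<Rightarrow> 's measure \<Rightarrow> ('w \<Rightarrow> 's) \<Rightarrow> ('w \<Rightarrow> nat) \<Rightarrow> nat \<Rightarrow> 's measure" where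
  "class_distr M S X Y y = distr (restrict_space M {w \<in> space M. Y w = y}) S X"

lemma measure_class_distr:
  assumes X: "X \<in> measurable M S" and Y: "Y \<in> measurable M (count_space I)"
    and B: "B \<in> sets S"
  shows "measure (class_distr M S X Y y) B = measure M {w \<in> space M. Y w = y \<and> X w \<in> B}"
proof -
  have E: "{w \<in> space M. Y w = y} \<in> sets M"
  proof (cases "y \<in> I")
    case True
    then have "Y -` {y} \<inter> space M \<in> sets M"
      by (intro measurable_sets[OF Y]) auto
    moreover have "Y -` {y} \<inter> space M = {w \<in> space M. Y w = y}" by auto
    ultimately show ?thesis by simp
  next
    case False
    then have "{w \<in> space M. Y w = y} = {}"
      using measurable_space[OF Y] by auto
    then show ?thesis by (simp only: sets.empty_sets)
  qed
  let ?R = "restrict_space M {w \<in> space M. Y w = y}"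
  have sp: "space ?R = {w \<in> space M. Y w = y}"
    by (auto simp: space_restrict_space)
  have XR: "X \<in> measurable ?R S"
    using X by (rule measurable_restrict_space1)
  have "measure (class_distr M S X Y y) B = measure ?R (X -` B \<inter> space ?R)"
    unfolding class_distr_def by (rule measure_distr[OF XR B])
  also have "\<dots> = measure M (X -` B \<inter> space ?R)"
    using E by (intro measure_restrict_space) (auto simp: sp)
  also have "X -` B \<inter> space ?R = {w \<in> space M. Y w = y \<and> X w \<in> B}"
    by (auto simp: sp)
  finally show ?thesis .
qed

text \<open>A version of the Radon--Nikodym derivative. Nonnegativity is required because
  \<open>ennreal\<close> sends negative reals to 0.\<close>

definition is_RN_density :: "'s measure \<Rightarrow> 's measure \<Rightarrow> ('s \<Rightarrow> real) \<Rightarrow> bool" where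
  "is_RN_density \<nu> \<mu> f \<longleftrightarrow>
     f \<in> borel_measurable \<mu> \<and> (\<forall>x\<in>space \<mu>. 0 \<le> f x) \<and> density \<mu> (\<lambda>x. ennreal (f x)) = \<nu>"

text \<open>In HOL, \<open>ln 0\<close> is a real number, so \<open>0 * ln 0 = 0\<close> below.\<close>

definition cond_entropy :: "'s measure \<Rightarrow> nat \<Rightarrow> (nat \<Rightarrow> 's \<Rightarrow> real) \<Rightarrow> real" where
  "cond_entropy \<mu> k \<rho> = - (LINT x|\<mu>. (\<Sum>y=1..k. \<rho> y x * ln (\<rho> y x)))"

definition Delta :: "'s measure \<Rightarrow> nat \<Rightarrow> (nat \<Rightarrow> 's measure) \<Rightarrow> real" where
  "Delta S k \<mu>s =
     (\<Sum>z=1..k. \<Sum>y\<in>{1..<z}. tv_norm S (\<lambda>B. measure (\<mu>s y) B - measure (\<mu>s z) B))"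

definition L_Delta :: "nat \<Rightarrow> real \<Rightarrow> real" where
  "L_Delta k D = 1 - (1 + D) / real k"

definition h2 :: "real \<Rightarrow> real" where
  "h2 p = - p * ln p - (1 - p) * ln (1 - p)"

definition Phi :: "nat \<Rightarrow> real \<Rightarrow> real" where
  "Phi k p = p * ln (real k - 1) + h2 p"

definition L_FM :: "nat \<Rightarrow> real \<Rightarrow> real" where
  "L_FM k h = the_inv_into {0..1 - 1 / real k} (Phi k) h"

text \<open>On a finite measure space, the total variation norm of a difference of two measures
  is the \<open>L\<^sup>1\<close> distance of their densities.\<close>

lemma tv_norm_density:
  fixes f g :: "'s \<Rightarrow> real"
  assumes fin: "finite_measure \<mu>" "finite_measure M" "finite_measure N"
    and S: "sets \<mu> = sets S"
    and f: "is_RN_density M \<mu> f" and g: "is_RN_density N \<mu> g"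
  shows "tv_norm S (\<lambda>B. measure M B - measure N B) = (LINT x|\<mu>. \<bar>f x - g x\<bar>)"
proof -
  interpret finite_measure \<mu> by fact
  have aux: "integrable \<mu> u \<and> (\<forall>A\<in>sets \<mu>. measure K A = (LINT x|\<mu>. indicator A x * u x))"
    if u: "is_RN_density K \<mu> u" and K: "finite_measure K" for u K
  proof -
    have um: "u \<in> borel_measurable \<mu>" and u0: "\<And>x. x \<in> space \<mu> \<Longrightarrow> 0 \<le> u x"
      and uK: "K = density \<mu> (\<lambda>x. ennreal (u x))"
      using u unfolding is_RN_density_def by auto
    have em: "emeasure K A = (\<integral>\<^sup>+x. ennreal (indicator A x * u x) \<partial>\<mu>)"
      if "A \<in> sets \<mu>" for A
      unfolding uK using um that
      by (subst emeasure_density) (auto intro!: nn_integral_cong simp: indicator_def)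
    have "emeasure K (space \<mu>) = (\<integral>\<^sup>+x. ennreal (u x) \<partial>\<mu>)"
      by (subst em) (auto intro!: nn_integral_cong)
    moreover have "emeasure K (space \<mu>) < \<infinity>"
      using finite_measure.emeasure_finite[OF K] by (simp add: top.not_eq_extremum)
    ultimately have i: "integrable \<mu> u"
      using um u0 by (intro integrableI_nonneg) auto
    have "measure K A = (LINT x|\<mu>. indicator A x * u x)" if "A \<in> sets \<mu>" for A
    proof -
      have "integrable \<mu> (\<lambda>x. indicator A x * u x)"
        using integrable_mult_indicator[OF that i] by simp
      then have "emeasure K A = ennreal (LINT x|\<mu>. indicator A x * u x)"
        unfolding em[OF that] using u0 by (intro nn_integral_eq_integral) auto
      moreover have "0 \<le> (LINT x|\<mu>. indicator A x * u x)"
        using u0 by (intro integral_nonneg_AE) auto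
      ultimately show ?thesis by (simp add: measure_def)
    qed
    with i show ?thesis by blast
  qed
  have fi: "integrable \<mu> f" and gi: "integrable \<mu> g"
    using aux[OF f fin(2)] aux[OF g fin(3)] by auto
  define d where "d x = f x - g x" for x
  have di: "integrable \<mu> d" unfolding d_def using fi gi by simp
  have dA: "integrable \<mu> (\<lambda>x. indicator A x * d x)"
    and aA: "integrable \<mu> (\<lambda>x. indicator A x * \<bar>d x\<bar>)" if "A \<in> sets \<mu>" for A
    using integrable_mult_indicator[OF that di]
      integrable_mult_indicator[OF that integrable_abs[OF di]] by simp_all
  have nu: "measure M A - measure N A = (LINT x|\<mu>. indicator A x * d x)"
    if A: "A \<in> sets \<mu>" for A
  proof -
    have "(LINT x|\<mu>. indicator A x * f x) - (LINT x|\<mu>. indicator A x * g x)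
        = (LINT x|\<mu>. indicator A x * f x - indicator A x * g x)"
      using integrable_mult_indicator[OF A fi] integrable_mult_indicator[OF A gi]
      by (intro Bochner_Integration.integral_diff[symmetric]) simp_all
    then show ?thesis
      using aux[OF f fin(2)] aux[OF g fin(3)] A by (simp add: d_def right_diff_distrib)
  qed
  have sp: "space \<mu> = space S" using S by (rule sets_eq_imp_space_eq)
  let ?PP = "{P. partition_on (space S) P \<and> finite P \<and> P \<subseteq> sets S}"
  let ?s = "\<lambda>P. \<Sum>A\<in>P. \<bar>measure M A - measure N A\<bar>"
  have tot: "(\<Sum>A\<in>P. LINT x|\<mu>. indicator A x * u x) = (LINT x|\<mu>. u x)"
    if P: "P \<in> ?PP" and ui: "\<And>A. A \<in> sets \<mu> \<Longrightarrow> integrable \<mu> (\<lambda>x. indicator A x * u x)"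
    for P and u :: "'s \<Rightarrow> real"
  proof -
    have "(\<Sum>A\<in>P. LINT x|\<mu>. indicator A x * u x) = (LINT x|\<mu>. (\<Sum>A\<in>P. indicator A x * u x))"
      using P S ui by (intro Bochner_Integration.integral_sum[symmetric]) auto
    also have "\<dots> = (LINT x|\<mu>. u x)"
    proof (rule Bochner_Integration.integral_cong[OF refl])
      fix x assume x: "x \<in> space \<mu>"
      have "\<Union>P = space \<mu>" using P sp by (auto simp: partition_on_def)
      with x obtain A where A: "A \<in> P" "x \<in> A" by blast
      have "(\<Sum>B\<in>P. indicator B x * u x) = (\<Sum>B\<in>P. if B = A then u x else 0)"
      proof (rule sum.cong[OF refl])
        fix B assume B: "B \<in> P"
        have disj: "x \<notin> B" if "B \<noteq> A"
          using A B P that unfolding partition_on_def disjoint_def by blast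
        show "indicator B x * u x = (if B = A then u x else 0)"
          using A disj by (auto simp: indicator_def)
      qed
      also have "\<dots> = u x" using A P by simp
      finally show "(\<Sum>B\<in>P. indicator B x * u x) = u x" .
    qed
    finally show ?thesis .
  qed
  have up: "?s P \<le> (LINT x|\<mu>. \<bar>d x\<bar>)" if P: "P \<in> ?PP" for P
  proof -
    have "?s P \<le> (\<Sum>A\<in>P. LINT x|\<mu>. indicator A x * \<bar>d x\<bar>)"
    proof (rule sum_mono)
      fix A assume "A \<in> P"
      then have A: "A \<in> sets \<mu>" using P S by auto
      have "\<bar>measure M A - measure N A\<bar> \<le> (LINT x|\<mu>. \<bar>indicator A x * d x\<bar>)"
        unfolding nu[OF A] by (rule integral_abs_bound)
      then show "\<bar>measure M A - measure N A\<bar> \<le> (LINT x|\<mu>. indicator A x * \<bar>d x\<bar>)"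
        by (simp add: abs_mult)
    qed
    also have "\<dots> = (LINT x|\<mu>. \<bar>d x\<bar>)" by (rule tot[OF P aA])
    finally show ?thesis .
  qed
  define Q where "Q = {{x \<in> space \<mu>. 0 \<le> d x}, {x \<in> space \<mu>. d x < 0}} - {{}}"
  have dm: "d \<in> borel_measurable \<mu>" using di by auto
  have Q: "Q \<in> ?PP"
  proof -
    have "{x \<in> space \<mu>. 0 \<le> d x} \<in> sets \<mu>" "{x \<in> space \<mu>. d x < 0} \<in> sets \<mu>"
      using dm by measurable
    then have "finite Q" "Q \<subseteq> sets S" unfolding Q_def S by auto
    moreover have "partition_on (space S) Q"
    proof (rule partition_onI)
      have "\<Union>({A, B} - {{}}) = A \<union> B" for A B :: "'s set" by blast
      then have "\<Union>Q = {x \<in> space \<mu>. 0 \<le> d x} \<union> {x \<in> space \<mu>. d x < 0}"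
        unfolding Q_def .
      also have "\<dots> = space S" unfolding sp[symmetric] by (auto simp only: not_le[symmetric])
      finally show "\<Union>Q = space S" .
      show "disjnt p q" if "p \<in> Q" "q \<in> Q" "p \<noteq> q" for p q
      proof -
        have "{x \<in> space \<mu>. 0 \<le> d x} \<inter> {x \<in> space \<mu>. d x < 0} = {}" by auto
        then show ?thesis using that unfolding Q_def disjnt_def by blast
      qed
      show "{} \<notin> Q" unfolding Q_def by blast
    qed
    ultimately show ?thesis by blast
  qed
  have "?s Q = (\<Sum>A\<in>Q. LINT x|\<mu>. indicator A x * \<bar>d x\<bar>)"
  proof (rule sum.cong[OF refl])
    fix A assume AQ: "A \<in> Q"
    then have A: "A \<in> sets \<mu>" using Q S by auto
    from AQ consider "A = {x \<in> space \<mu>. 0 \<le> d x}" | "A = {x \<in> space \<mu>. d x < 0}"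
      unfolding Q_def by auto
    then show "\<bar>measure M A - measure N A\<bar> = (LINT x|\<mu>. indicator A x * \<bar>d x\<bar>)"
    proof cases
      case 1
      have "(LINT x|\<mu>. indicator A x * d x) = (LINT x|\<mu>. indicator A x * \<bar>d x\<bar>)"
        by (intro Bochner_Integration.integral_cong) (auto simp: 1 indicator_def)
      moreover have "0 \<le> (LINT x|\<mu>. indicator A x * \<bar>d x\<bar>)"
        by (intro integral_nonneg_AE) auto
      ultimately show ?thesis unfolding nu[OF A] by simp
    next
      case 2
      have "(LINT x|\<mu>. indicator A x * d x) = (LINT x|\<mu>. - (indicator A x * \<bar>d x\<bar>))"
        by (intro Bochner_Integration.integral_cong) (auto simp: 2 indicator_def)
      moreover have "0 \<le> (LINT x|\<mu>. indicator A x * \<bar>d x\<bar>)"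
        by (intro integral_nonneg_AE) auto
      ultimately show ?thesis unfolding nu[OF A] by simp
    qed
  qed
  also have "\<dots> = (LINT x|\<mu>. \<bar>d x\<bar>)" by (rule tot[OF Q aA])
  finally have sQ: "?s Q = (LINT x|\<mu>. \<bar>d x\<bar>)" .
  have "(SUP P \<in> ?PP. ?s P) = (LINT x|\<mu>. \<bar>d x\<bar>)"
  proof (rule cSup_eq_maximum)
    show "(LINT x|\<mu>. \<bar>d x\<bar>) \<in> ?s ` ?PP"
      unfolding sQ[symmetric] using Q by (rule imageI)
  next
    fix v assume "v \<in> ?s ` ?PP"
    then obtain P where "P \<in> ?PP" "v = ?s P" by (rule imageE)
    with up show "v \<le> (LINT x|\<mu>. \<bar>d x\<bar>)" by (simp only:)
  qed
  then show ?thesis unfolding tv_norm_def d_def .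
qed

end

theory Submission
  imports Defs "HOL-Real_Asymp.Real_Asymp"
begin

text \<open>
  At every point \<open>x\<close> the posterior distribution of \<open>Y\<close> is uniform on some \<open>l\<close>-element subset of
  \<open>{1..k}\<close>. Both \<open>\<Delta>\<close> and \<open>H\<close> are integrals of symmetric functions of the posterior, so their
  integrands are constant: \<open>\<Delta> = k - l\<close> (\<open>uniform_sum_abs_diff\<close>: each of the \<open>l (k - l)\<close> pairs of an
  atom and a non-atom contributes \<open>1/l\<close>) and \<open>H = ln l\<close> (\<open>uniform_sum_x_ln_x\<close>). Hence
  \<open>L(\<Delta>) = p\<close> with \<open>p = (l - 1)/k\<close>, and because \<open>\<Phi>\<close> is continuous and strictly increasing on
  \<open>[0, 1 - 1/k]\<close>, the claim is equivalent to the numerical inequality \<open>ln l < \<Phi>(p)\<close>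
  (\<open>L_FM_less\<close>, \<open>ln_less_Phi\<close>).

  Put \<open>m = k - l\<close>. Multiplying by \<open>k\<close> and collecting logarithms turns this inequality into
  \<open>(m+1) ln (m+1) < (l-1) ln ((l+m-1)/(l-1)) + (l+m) ln ((l+m)/l)\<close>.
  For fixed \<open>m\<close> the right-hand side tends to \<open>2m\<close> as \<open>l\<close> grows, and \<open>2m > (m+1) ln (m+1)\<close> holds
  precisely for \<open>m = 1, 2, 3\<close>. For \<open>m = 4\<close> the limit falls just short, so that only
  small \<open>l\<close> remain, here \<open>l = 2, 3, 4, 5\<close>. The inequality \<open>ln x \<ge> 2 (x-1)/(x+1)\<close> for \<open>x > 1\<close>,
  whose sides agree to second order at \<open>x = 1\<close>, bounds the right-hand side from below by \<open>2m\<close> minus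
  an explicit rational function that decreases in \<open>l\<close> (\<open>entropy_gap_Pade\<close>). This settles
  \<open>m \<le> 3\<close> except for \<open>(m, l) = (3, 2)\<close>; that case and the four cases with \<open>m = 4\<close> become, after
  exponentiation, comparisons of rational numbers.
\<close>

section \<open>The Feder--Merhav function and its inverse\<close>

lemma continuous_on_x_ln_x: "continuous_on {0..} (\<lambda>x::real. x * ln x)"
proof -
  have "((\<lambda>x::real. x * ln x) \<longlongrightarrow> 0) (at_right 0)"
    by real_asymp
  then have "continuous (at 0 within {0..}) (\<lambda>x::real. x * ln x)"
    by (simp add: continuous_within at_within_Ici_at_right)
  moreover have "continuous (at x within {0..}) (\<lambda>x::real. x * ln x)" if "x > 0" for x
    using that by (intro continuous_intros) auto
  ultimately show ?thesis
    unfolding continuous_on_eq_continuous_within by (metis atLeast_iff order_le_less)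
qed

lemma continuous_on_Phi: "continuous_on {0..1} (Phi k)"
proof -
  have 1: "continuous_on {0..1} (\<lambda>p::real. p * ln p)"
    by (rule continuous_on_subset[OF continuous_on_x_ln_x]) auto
  have 2: "continuous_on {0..1} (\<lambda>p::real. (1 - p) * ln (1 - p))"
    by (rule continuous_on_compose2[OF continuous_on_x_ln_x]) (auto intro!: continuous_intros)
  have "Phi k = (\<lambda>p. p * ln (real k - 1) - p * ln p - (1 - p) * ln (1 - p))"
    by (auto simp: Phi_def h2_def)
  then show ?thesis
    using 1 2 by (auto intro!: continuous_intros)
qed

lemma Phi_0: "Phi k 0 = 0"
  by (simp add: Phi_def h2_def)

lemma Phi_strict_mono:
  assumes "k \<ge> 2" "0 \<le> p" "p < q" "q \<le> 1 - 1 / real k"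
  shows "Phi k p < Phi k q"
proof (rule DERIV_pos_imp_increasing_open[OF \<open>p < q\<close>])
  have "q \<le> 1" using assms by (smt (verit) divide_nonneg_nonneg of_nat_0_le_iff)
  then show "continuous_on {p..q} (Phi k)"
    using assms by (intro continuous_on_subset[OF continuous_on_Phi]) auto
next
  fix t assume t: "p < t" "t < q"
  then have "t < 1 - 1 / real k" using assms by simp
  then have tk: "real k * t < real k - 1"
    using assms by (simp add: field_simps)
  have t01: "0 < t" "t < 1"
    using t assms by (auto, smt (verit) divide_nonneg_nonneg of_nat_0_le_iff)
  \<comment> \<open>The derivative of \<open>\<Phi>\<close> at \<open>t\<close> is \<open>ln ((k - 1) (1 - t) / t)\<close>, positive exactly for \<open>t < 1 - 1/k\<close>.\<close>
  have "t < (real k - 1) * (1 - t)"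
    using tk by (simp add: algebra_simps)
  then have "ln t < ln ((real k - 1) * (1 - t))"
    using t01 assms by (intro ln_less_cancel_iff[THEN iffD2]) auto
  also have "\<dots> = ln (real k - 1) + ln (1 - t)"
    using t01 assms by (intro ln_mult_pos) auto
  finally have pos: "0 < ln (real k - 1) - ln t + ln (1 - t)" by simp
  have "((\<lambda>p. p * ln (real k - 1) + (- p * ln p - (1 - p) * ln (1 - p)))
      has_real_derivative ln (real k - 1) - ln t + ln (1 - t)) (at t)"
    using t01 by (auto intro!: derivative_eq_intros simp: divide_simps)
  then show "\<exists>y. DERIV (Phi k) t :> y \<and> 0 < y"
    using pos unfolding Phi_def[abs_def] h2_def by blast
qed

text \<open>
  The intermediate value theorem on \<open>[0, p]\<close> gives a preimage of \<open>h\<close> other than \<open>p\<close>; the injectivity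
  of \<open>\<Phi>\<close> on the larger interval, which is the one in the definition of \<open>L_FM\<close>, identifies it as
  the value of the inverse.
\<close>
lemma L_FM_less:
  assumes k: "k \<ge> 2" and p: "p \<le> 1 - 1 / real k" "0 \<le> p" and h: "0 \<le> h" "h < Phi k p"
  shows "L_FM k h < p"
proof -
  have p1: "p \<le> 1" using p by (smt (verit) divide_nonneg_nonneg of_nat_0_le_iff)
  have "\<exists>q\<ge>0. q \<le> p \<and> Phi k q = h"
    using h p p1 by (intro IVT' continuous_on_subset[OF continuous_on_Phi]) (auto simp: Phi_0)
  then obtain q where q: "0 \<le> q" "q \<le> p" "Phi k q = h" by blast
  have "inj_on (Phi k) {0..1 - 1 / real k}"
  proof (rule linorder_inj_onI)
    fix x y assume "x < y" "x \<in> {0..1 - 1 / real k}" "y \<in> {0..1 - 1 / real k}"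
    then show "Phi k x \<noteq> Phi k y"
      using Phi_strict_mono[OF k, of x y] by auto
  qed auto
  then have "L_FM k h = q"
    unfolding L_FM_def using q p by (intro the_inv_into_f_eq) auto
  moreover have "q \<noteq> p" using q h by auto
  ultimately show ?thesis using q by simp
qed

section \<open>The entropy gap\<close>

text \<open>
  The right-hand side is the Pade approximant of order \<open>[1/1]\<close> to \<open>ln\<close> at \<open>1\<close>, and also the first
  term of \<open>ln x = 2 artanh ((x - 1)/(x + 1))\<close>, whose series has only positive terms. The simpler
  bound \<open>1 - 1/x\<close> would be too weak below when \<open>m\<close> is \<open>2\<close> or \<open>3\<close> and \<open>l\<close> is small.
\<close>
lemma ln_ge_Pade:
  fixes x :: real
  assumes "x > 1"
  shows "2 * (x - 1) / (x + 1) \<le> ln x"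
  using ln_approx_bounds[of x 1] assms by simp

text \<open>
  A strict inequality between integer combinations of logarithms of rational numbers is decided by
  exact arithmetic after exponentiation.
\<close>
lemma ln_lincomb_less:
  fixes a b c :: nat and x y z :: real
  assumes "x > 0" "y > 0" "z > 0" "z ^ c < x ^ a * y ^ b"
  shows "real c * ln z < real a * ln x + real b * ln y"
proof -
  have "ln (z ^ c) < ln (x ^ a * y ^ b)"
    using assms by (intro ln_less_cancel_iff[THEN iffD2]) auto
  then show ?thesis
    using assms by (simp add: ln_mult_pos ln_realpow)
qed

text \<open>
  With \<open>s = 2l + m\<close>, the bound \<open>ln_ge_Pade\<close> turns the two logarithms into \<open>2m/(s - 2)\<close> and \<open>2m/s\<close>.
  Writing the coefficients as \<open>l - 1 = ((s - 2) - m)/2\<close> and \<open>l + m = (s + m)/2\<close>, the two products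
  are \<open>m - m\<^sup>2/(s - 2)\<close> and \<open>m + m\<^sup>2/s\<close>, so the terms of order \<open>1/l\<close> cancel.
\<close>
lemma entropy_gap_Pade:
  fixes l m :: real
  assumes "l > 1" "m > 0"
  shows "2 * m - 2 * m\<^sup>2 / ((2 * l + m) * (2 * l + m - 2))
     \<le> (l - 1) * ln ((l + m - 1) / (l - 1)) + (l + m) * ln ((l + m) / l)"
proof -
  have e1: "2 * ((l + m - 1) / (l - 1) - 1) / ((l + m - 1) / (l - 1) + 1) = 2 * m / (2 * l + m - 2)"
    using assms by (simp add: divide_simps)
  have e2: "2 * ((l + m) / l - 1) / ((l + m) / l + 1) = 2 * m / (2 * l + m)"
    using assms by (simp add: divide_simps)
  have "2 * m / (2 * l + m - 2) \<le> ln ((l + m - 1) / (l - 1))"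
    using ln_ge_Pade[of "(l + m - 1) / (l - 1)"] assms unfolding e1 by simp
  then have 1: "(l - 1) * (2 * m / (2 * l + m - 2)) \<le> (l - 1) * ln ((l + m - 1) / (l - 1))"
    using assms by (intro mult_left_mono) auto
  have "2 * m / (2 * l + m) \<le> ln ((l + m) / l)"
    using ln_ge_Pade[of "(l + m) / l"] assms unfolding e2 by simp
  then have 2: "(l + m) * (2 * m / (2 * l + m)) \<le> (l + m) * ln ((l + m) / l)"
    using assms by (intro mult_left_mono) auto
  have nz: "2 * l + m \<noteq> 0" "2 * l + m - 2 \<noteq> 0" using assms by auto
  have "(l - 1) * (2 * m / (2 * l + m - 2)) + (l + m) * (2 * m / (2 * l + m))
      = 2 * m - 2 * m\<^sup>2 / ((2 * l + m) * (2 * l + m - 2))"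
    using nz by (simp add: divide_simps) (simp add: algebra_simps power2_eq_square)
  then show ?thesis using 1 2 by linarith
qed

lemma entropy_gap_pos:
  fixes l m :: nat
  assumes l: "l \<ge> 2" and m: "m \<in> {1, 2, 3} \<or> m = 4 \<and> l \<le> 5"
  shows "(real m + 1) * ln (real m + 1)
    < (real l - 1) * ln ((real l + real m - 1) / (real l - 1))
      + (real l + real m) * ln ((real l + real m) / real l)"
    (is "_ < ?R")
proof -
  have Pade: "2 * real m - 2 * (real m)\<^sup>2 / D \<le> ?R"
    if "0 < D" "D \<le> (2 * real l + real m) * (2 * real l + real m - 2)" "m > 0" for D
  proof -
    have "2 * (real m)\<^sup>2 / ((2 * real l + real m) * (2 * real l + real m - 2)) \<le> 2 * (real m)\<^sup>2 / D"
      using that by (intro divide_left_mono) auto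
    then show ?thesis
      using entropy_gap_Pade[of "real l" "real m"] l that by linarith
  qed
  have D: "(2 * c + real m) * (2 * c + real m - 2)
      \<le> (2 * real l + real m) * (2 * real l + real m - 2)" if "1 \<le> c" "c \<le> real l" for c
    using that by (intro mult_mono) auto
  \<comment> \<open>For \<open>m \<le> 3\<close> the smallest admissible \<open>l\<close> is the worst case for the rational bound, and that bound
    beats \<open>(m + 1) ln (m + 1)\<close> already at \<open>l = 2\<close>, except for \<open>m = 3\<close>, where it does so from \<open>l = 3\<close> on.\<close>
  consider "m = 1" | "m = 2" | "m = 3" "l \<ge> 3" | "m = 3" "l = 2"
    | "m = 4" "l = 2" | "m = 4" "l = 3" | "m = 4" "l = 4" | "m = 4" "l = 5"
    using assms by force
  then show ?thesis
  proof cases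
    case 1
    then show ?thesis
      using Pade[OF _ D, of 2] l ln2_le_25_over_36 by simp
  next
    case 2
    have "ln (3::real) = ln 2 + ln (1 + 1 / 2)"
      by (subst ln_mult_pos[symmetric]) auto
    also have "\<dots> \<le> 25 / 36 + 1 / 2"
      using ln2_le_25_over_36 ln_add_one_self_le_self[of "1/2"] by linarith
    finally show ?thesis
      using Pade[OF _ D, of 2] l 2 by simp
  next
    case 3
    have "ln (4::real) = ln 2 + ln 2"
      by (subst ln_mult_pos[symmetric]) auto
    then show ?thesis
      using Pade[OF _ D, of 3] 3 ln2_le_25_over_36 by simp
  next
    case 4
    then show ?thesis
      using ln_lincomb_less[of 4 "5/2" 4 4 1 5] by (simp add: power_divide)
  next
    case 5
    then show ?thesis
      using ln_lincomb_less[of 5 "3" 5 5 1 6] by (simp add: power_divide)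
  next
    case 6
    then show ?thesis
      using ln_lincomb_less[of 3 "7/3" 5 5 2 7] by (simp add: power_divide)
  next
    case 7
    then show ?thesis
      using ln_lincomb_less[of "7/3" 2 5 5 3 8] by (simp add: power_divide)
  next
    case 8
    then show ?thesis
      using ln_lincomb_less[of 2 "9/5" 5 5 4 9] by (simp add: power_divide)
  qed
qed

text \<open>
  Multiplied by \<open>k = l + m\<close>, the difference of the two sides is that of \<open>entropy_gap_pos\<close>,
  since \<open>k p = l - 1\<close> and \<open>k (1 - p) = m + 1\<close> for \<open>p = (l - 1)/k\<close>.
\<close>
lemma ln_less_Phi:
  fixes l m :: nat
  assumes l: "l \<ge> 2" and m: "m \<in> {1, 2, 3} \<or> m = 4 \<and> l \<le> 5"
  shows "ln (real l) < Phi (l + m) ((real l - 1) / real (l + m))"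
proof -
  let ?k = "real l + real m"
  let ?p = "(real l - 1) / ?k"
  have pos: "?k > 0" "real l - 1 > 0" "real m > 0" using l m by auto
  have q: "1 - ?p = (real m + 1) / ?k" using pos by (simp add: field_simps)
  have kp: "?k * ?p = real l - 1" "?k * ((real m + 1) / ?k) = real m + 1" using pos by auto
  have "?k * Phi (l + m) ?p =
      (?k * ?p) * ln (?k - 1) - (?k * ?p) * ln ?p
      - (?k * ((real m + 1) / ?k)) * ln ((real m + 1) / ?k)"
    unfolding Phi_def h2_def q by (simp only: of_nat_add) (simp add: algebra_simps)
  also have "\<dots> = (real l - 1) * (ln (?k - 1) - ln (real l - 1) + ln ?k)
      - (real m + 1) * (ln (real m + 1) - ln ?k)"
    unfolding kp using pos by (simp add: ln_divide_pos algebra_simps)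
  also have "\<dots> = ?k * ln (real l) + ((real l - 1) * ln ((?k - 1) / (real l - 1))
      + ?k * ln (?k / real l) - (real m + 1) * ln (real m + 1))"
    using pos by (simp add: ln_divide_pos algebra_simps)
  finally have "?k * ln (real l) < ?k * Phi (l + m) ?p"
    using entropy_gap_pos[OF assms] by linarith
  then show ?thesis using pos by simp
qed

section \<open>Uniform posterior distributions\<close>

lemma sum_square_eq_twice_sum_less:
  fixes f :: "nat \<Rightarrow> nat \<Rightarrow> real"
  assumes "\<And>y z. f y z = f z y" "\<And>z. f z z = 0"
  shows "(\<Sum>z=1..k. \<Sum>y=1..k. f y z) = 2 * (\<Sum>z=1..k. \<Sum>y\<in>{1..<z}. f y z)"
proof (induction k)
  case (Suc k)
  have "(\<Sum>z=1..k. f (Suc k) z) = (\<Sum>z=1..k. f z (Suc k))"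
    using assms(1) by (intro sum.cong) auto
  then show ?case
    using Suc assms(2) by (simp add: sum.distrib atLeastLessThanSuc_atLeastAtMost)
qed simp

lemma uniform_sum_abs_diff:
  fixes b :: "nat \<Rightarrow> real"
  assumes A: "A \<subseteq> {1..k}" "card A = l" "l > 0"
    and b: "\<And>y. y \<in> {1..k} \<Longrightarrow> b y = (if y \<in> A then 1 / real l else 0)"
  shows "(\<Sum>z=1..k. \<Sum>y\<in>{1..<z}. \<bar>b y - b z\<bar>) = real k - real l"
proof -
  have sb: "sum b {1..k} = 1"
  proof -
    have "sum b {1..k} = (\<Sum>y\<in>{1..k}. if y \<in> A then 1 / real l else 0)"
      using b by (intro sum.cong) auto
    also have "\<dots> = (\<Sum>y\<in>{1..k} \<inter> A. 1 / real l)" by (rule sum.inter_restrict[symmetric]) simp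
    also have "{1..k} \<inter> A = A" using A by auto
    finally show ?thesis using A by simp
  qed
  have "2 * (\<Sum>z=1..k. \<Sum>y\<in>{1..<z}. \<bar>b y - b z\<bar>) = (\<Sum>z=1..k. \<Sum>y=1..k. \<bar>b y - b z\<bar>)"
    by (rule sum_square_eq_twice_sum_less[symmetric]) auto
  \<comment> \<open>As \<open>b\<close> takes only the values \<open>0\<close> and \<open>1/l\<close>, the absolute value is a polynomial in \<open>b y\<close> and
    \<open>b z\<close>, and the double sum depends only on the total mass.\<close>
  also have "\<dots> = (\<Sum>z=1..k. \<Sum>y=1..k. b y + b z - 2 * real l * (b z * b y))"
    using b A by (intro sum.cong) auto
  also have "\<dots> = 2 * (real k - real l)"
    by (simp add: sum.distrib sum_subtractf sum_distrib_left[symmetric] sum_distrib_right[symmetric]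
        sb[simplified])
  finally show ?thesis by simp
qed

lemma uniform_sum_x_ln_x:
  fixes b :: "nat \<Rightarrow> real"
  assumes A: "A \<subseteq> {1..k}" "card A = l" "l > 0"
    and b: "\<And>y. y \<in> {1..k} \<Longrightarrow> b y = (if y \<in> A then 1 / real l else 0)"
  shows "(\<Sum>y=1..k. b y * ln (b y)) = - ln (real l)"
proof -
  have "(\<Sum>y=1..k. b y * ln (b y)) = (\<Sum>y\<in>{1..k}. if y \<in> A then 1 / real l * ln (1 / real l) else 0)"
    using b by (intro sum.cong) auto
  also have "\<dots> = (\<Sum>y\<in>{1..k} \<inter> A. 1 / real l * ln (1 / real l))"
    by (rule sum.inter_restrict[symmetric]) simp
  also have "{1..k} \<inter> A = A" using A by auto
  finally show ?thesis using A by (simp add: ln_div)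
qed

lemma finite_measure_class_distr:
  assumes "finite_measure M" and X: "X \<in> measurable M S"
    and Y: "Y \<in> measurable M (count_space I)" and y: "y \<in> I"
  shows "finite_measure (class_distr M S X Y y)"
proof -
  have "Y -` {y} \<inter> space M \<in> sets M"
    using y by (intro measurable_sets[OF Y]) auto
  moreover have "Y -` {y} \<inter> space M = {w \<in> space M. Y w = y}" by auto
  ultimately have "finite_measure (restrict_space M {w \<in> space M. Y w = y})"
    using assms(1) by (intro finite_measure_restrict_space) simp_all
  then show ?thesis
    unfolding class_distr_def
    by (rule finite_measure.finite_measure_distr) (rule measurable_restrict_space1[OF X])
qed

theorem proposition7:
  fixes k l :: nat
    and M :: "'w measure" and S :: "'s measure"
    and X :: "'w \<Rightarrow> 's" and Y :: "'w \<Rightarrow> nat"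
    and \<rho> :: "nat \<Rightarrow> 's \<Rightarrow> real" and a :: "nat \<Rightarrow> real"
  assumes "k \<ge> 3" and "l \<ge> 2"
    and "l \<in> {k - 3, k - 2, k - 1} \<or> (k \<in> {6, 7, 8, 9} \<and> l = k - 4)"
    and "prob_space M"
    and "X \<in> measurable M S"
    and "Y \<in> measurable M (count_space {1..k})"
    and "\<And>y. y \<in> {1..k} \<Longrightarrow>
           is_RN_density (class_distr M S X Y y) (distr M S X) (\<rho> y)"
    and "\<And>i. i \<in> {1..k} \<Longrightarrow> a i = 1 / real l * indicator {1..l} i"
    and "\<And>x. x \<in> space S \<Longrightarrow>
           \<exists>\<pi>. \<pi> permutes {1..k} \<and> (\<forall>y\<in>{1..k}. \<rho> y x = a (\<pi> y))"
  shows "L_Delta k (Delta S k (class_distr M S X Y))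
           > L_FM k (cond_entropy (distr M S X) k \<rho>)"
proof -
  interpret M: prob_space M by fact
  let ?\<mu> = "distr M S X"
  interpret D: prob_space ?\<mu> using assms(5) by (rule M.prob_space_distr)
  let ?\<nu> = "class_distr M S X Y"
  note dens = assms(7)
  have lk: "l < k" using assms(1-3) by auto
  have unif: "\<exists>A. A \<subseteq> {1..k} \<and> card A = l \<and> (\<forall>y\<in>{1..k}. \<rho> y x = (if y \<in> A then 1 / real l else 0))"
    if "x \<in> space S" for x
  proof -
    obtain \<pi> where \<pi>: "\<pi> permutes {1..k}" "\<And>y. y \<in> {1..k} \<Longrightarrow> \<rho> y x = a (\<pi> y)"
      using assms(9)[OF \<open>x \<in> space S\<close>] by blast
    have bij: "bij_betw \<pi> {1..k} {1..k}" by (rule permutes_imp_bij[OF \<pi>(1)])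
    define A where "A = {y \<in> {1..k}. \<pi> y \<in> {1..l}}"
    have "{1..l} \<subseteq> \<pi> ` {1..k}"
      using bij lk by (auto simp: bij_betw_def)
    then have "\<pi> ` A = {1..l}"
      unfolding A_def by blast
    moreover have "inj_on \<pi> A"
      using bij unfolding bij_betw_def A_def by (auto intro: inj_on_subset)
    ultimately have "card A = l" using card_image[of \<pi> A] by simp
    moreover have "\<rho> y x = (if y \<in> A then 1 / real l else 0)" if "y \<in> {1..k}" for y
    proof -
      have "\<pi> y \<in> {1..k}" using bij that by (auto simp: bij_betw_def)
      then show ?thesis using \<pi>(2)[OF that] assms(8) that by (auto simp: A_def)
    qed
    ultimately show ?thesis unfolding A_def by (intro exI[of _ A]) (auto simp: A_def)
  qed
  have int: "integrable ?\<mu> (\<lambda>x. \<bar>\<rho> y x - \<rho> z x\<bar>)" if "y \<in> {1..k}" "z \<in> {1..k}" for y z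
  proof (rule D.integrable_const_bound[where B = 1])
    have "\<bar>\<rho> y x - \<rho> z x\<bar> \<le> 1" if "x \<in> space S" for x
      using unif[OF that] \<open>y \<in> {1..k}\<close> \<open>z \<in> {1..k}\<close> assms(2) by auto
    then show "AE x in ?\<mu>. norm \<bar>\<rho> y x - \<rho> z x\<bar> \<le> 1" by (intro AE_I2) simp
    show "(\<lambda>x. \<bar>\<rho> y x - \<rho> z x\<bar>) \<in> borel_measurable ?\<mu>"
      using dens[OF that(1)] dens[OF that(2)] unfolding is_RN_density_def
      by (intro borel_measurable_abs borel_measurable_diff) auto
  qed
  have fin: "finite_measure (?\<nu> y)" if "y \<in> {1..k}" for y
    using M.finite_measure_axioms assms(5,6) that by (rule finite_measure_class_distr)
  have "Delta S k ?\<nu> = (\<Sum>z=1..k. \<Sum>y\<in>{1..<z}. LINT x|?\<mu>. \<bar>\<rho> y x - \<rho> z x\<bar>)"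
    unfolding Delta_def
    by (intro sum.cong refl tv_norm_density D.finite_measure_axioms fin dens) auto
  also have "\<dots> = (LINT x|?\<mu>. (\<Sum>z=1..k. \<Sum>y\<in>{1..<z}. \<bar>\<rho> y x - \<rho> z x\<bar>))"
  proof -
    have "(LINT x|?\<mu>. (\<Sum>z=1..k. \<Sum>y\<in>{1..<z}. \<bar>\<rho> y x - \<rho> z x\<bar>))
        = (\<Sum>z=1..k. LINT x|?\<mu>. (\<Sum>y\<in>{1..<z}. \<bar>\<rho> y x - \<rho> z x\<bar>))"
      by (intro Bochner_Integration.integral_sum Bochner_Integration.integrable_sum int) auto
    also have "\<dots> = (\<Sum>z=1..k. \<Sum>y\<in>{1..<z}. LINT x|?\<mu>. \<bar>\<rho> y x - \<rho> z x\<bar>)"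
      by (intro sum.cong refl Bochner_Integration.integral_sum int) auto
    finally show ?thesis by simp
  qed
  also have "\<dots> = (LINT x|?\<mu>. real k - real l)"
  proof (rule Bochner_Integration.integral_cong[OF refl])
    fix x assume "x \<in> space ?\<mu>"
    then obtain A where "A \<subseteq> {1..k}" "card A = l"
      "\<And>y. y \<in> {1..k} \<Longrightarrow> \<rho> y x = (if y \<in> A then 1 / real l else 0)"
      using unif[of x] by auto
    then show "(\<Sum>z=1..k. \<Sum>y\<in>{1..<z}. \<bar>\<rho> y x - \<rho> z x\<bar>) = real k - real l"
      using assms(2) by (intro uniform_sum_abs_diff) auto
  qed
  finally have Delta: "Delta S k ?\<nu> = real k - real l" using D.prob_space by simp
  have "(LINT x|?\<mu>. (\<Sum>y=1..k. \<rho> y x * ln (\<rho> y x))) = (LINT x|?\<mu>. - ln (real l))"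
  proof (rule Bochner_Integration.integral_cong[OF refl])
    fix x assume "x \<in> space ?\<mu>"
    then obtain A where "A \<subseteq> {1..k}" "card A = l"
      "\<And>y. y \<in> {1..k} \<Longrightarrow> \<rho> y x = (if y \<in> A then 1 / real l else 0)"
      using unif[of x] by auto
    then show "(\<Sum>y=1..k. \<rho> y x * ln (\<rho> y x)) = - ln (real l)"
      using assms(2) by (intro uniform_sum_x_ln_x) auto
  qed
  then have H: "cond_entropy ?\<mu> k \<rho> = ln (real l)"
    unfolding cond_entropy_def using D.prob_space by simp
  have L: "L_Delta k (real k - real l) = (real l - 1) / real k"
    using lk by (simp add: L_Delta_def field_simps)
  have "ln (real l) < Phi (l + (k - l)) ((real l - 1) / real (l + (k - l)))"
    using assms(1-3) by (intro ln_less_Phi) auto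
  then have gap: "ln (real l) < Phi k ((real l - 1) / real k)" using lk by simp
  have "(real l - 1) / real k \<le> 1 - 1 / real k" using lk by (simp add: field_simps)
  then show ?thesis
    unfolding Delta H L using gap assms(1,2) by (intro L_FM_less) auto
qed

end
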